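(* If $\Phi=\{\varphi_i\}_{i\in I}$ is a tight frame for $\mathscr{H}$, then the frame expansions with respect to $\Phi$ have unconditional constant $1$ for all forms of unconditional, i.e. $C_\sigma = C_\varepsilon = C_a = 1$.
   Context: $\mathscr{H}$ is a (nonzero) separable, finite or infinite dimensional, real or complex Hilbert space. The index set $I$ is either $\{1,\dots,N\}$ or $\mathbb{N}$. A family $\{\varphi_i\}_{i\in I}$ in $\mathscr{H}$ is a tight frame for $\mathscr{H}$ if there is a constant $0<A<\infty$ with $\sum_{i\in I}|\langle x,\varphi_i\rangle|^2= A\|x\|^2$ for all $x\in\mathscr{H}$. The frame expansion of $x\in\mathscr{H}$ is $\sum_{i\in I}\langle x,\varphi_i\rangle\varphi_i$. The unconditional constants of the frame expansions are the smallest constants $C_\sigma, C_\varepsilon, C_a$ such that, for all $x\in\mathscr{H}$, $\|\sum_{i\in\sigma}\langle x,\varphi_i\rangle\varphi_i\|\le C_\sigma\|\sum_{i\in I}\langle x,\varphi_i\rangle\varphi_i\|$ for all $\sigma\subset I$; $\|\sum_{i\in I}\varepsilon_i\langle x,\varphi_i\rangle\varphi_i\|\le C_\varepsilon\|\sum_{i\in I}\langle x,\varphi_i\rangle\varphi_i\|$ for all $\varepsilon_i\in\{-1,1\}$; and $\|\sum_{i\in I}a_i\langle x,\varphi_i\rangle\varphi_i\|\le C_a\|\sum_{i\in I}\langle x,\varphi_i\rangle\varphi_i\|$ for all scalars $a_i$ with $|a_i|\le1$. *)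

theory Defs
  imports "HOL-Analysis.Analysis"
begin

text \<open>
  The scalar field. By the Gelfand-Mazur theorem a \<^class>\<open>real_normed_field\<close> is isometrically
  isomorphic to the reals or to the complex numbers; the class adds the (then unique)
  conjugation, so that real and complex Hilbert spaces can be treated uniformly.
\<close>

class rc_scalar = real_normed_field +
  fixes scnj :: "'a \<Rightarrow> 'a"
  assumes scnj_add: "scnj (z + w) = scnj z + scnj w"
    and scnj_mult: "scnj (z * w) = scnj z * scnj w"
    and mult_scnj: "z * scnj z = (norm z)\<^sup>2 *\<^sub>R 1"

instantiation real :: rc_scalar
begin

definition scnj_real :: "real \<Rightarrow> real" where
  "scnj_real z = z"

instance
  by standard (auto simp: scnj_real_def power2_eq_square)

end

instantiation complex :: rc_scalar
begin

definition scnj_complex :: "complex \<Rightarrow> complex" where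
  "scnj_complex z = cnj z"

instance
proof
  fix z w :: complex
  show "scnj (z + w) = scnj z + scnj w" "scnj (z * w) = scnj z * scnj w"
    by (simp_all add: scnj_complex_def)
  show "z * scnj z = (norm z)\<^sup>2 *\<^sub>R 1"
    unfolding scnj_complex_def scaleR_conv_of_real mult_1_right by (rule complex_norm_square[symmetric])
qed

end

text \<open>
  Completeness is part of \<^class>\<open>banach\<close>; the norm of the type is required to be the one induced
  by the inner product \<open>ip\<close>, which is linear in its first argument.
\<close>

locale hilbert_space = vector_space smul
  for smul :: "'k::rc_scalar \<Rightarrow> 'h::banach \<Rightarrow> 'h" +
  fixes ip :: "'h \<Rightarrow> 'h \<Rightarrow> 'k"
  assumes smul_of_real: "smul (of_real r) x = r *\<^sub>R x"
    and ip_add_left: "ip (x + y) z = ip x z + ip y z"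
    and ip_smul_left: "ip (smul c x) y = c * ip x y"
    and ip_commute: "ip x y = scnj (ip y x)"
    and ip_self: "ip x x = of_real ((norm x)\<^sup>2)"

lemma hilbert_space_real:
  "hilbert_space scaleR (inner :: 'a::{banach, real_inner} \<Rightarrow> 'a \<Rightarrow> real)"
proof unfold_locales
  fix x y z :: 'a and r c :: real
  show "of_real r *\<^sub>R x = r *\<^sub>R x"
    by simp
  show "inner (x + y) z = inner x z + inner y z"
    by (rule inner_add_left)
  show "inner (c *\<^sub>R x) y = c * inner x y"
    by simp
  show "inner x y = scnj (inner y x)"
    unfolding scnj_real_def by (rule inner_commute)
  show "inner x x = of_real ((norm x)\<^sup>2)"
    by (simp add: dot_square_norm)
qed

lemma hilbert_space_complex:
  "hilbert_space (*) (\<lambda>x y :: complex. x * cnj y)"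
proof unfold_locales
  fix x y z c :: complex and r :: real
  show "of_real r * x = r *\<^sub>R x"
    by (rule scaleR_conv_of_real[symmetric])
  show "(x + y) * cnj z = x * cnj z + y * cnj z"
    by (rule distrib_right)
  show "c * x * cnj y = c * (x * cnj y)"
    by (rule mult.assoc)
  show "x * cnj y = scnj (y * cnj x)"
    by (simp add: scnj_complex_def)
  show "x * cnj x = of_real ((norm x)\<^sup>2)"
    by (simp only: complex_norm_square)
qed

definition is_separable :: "'h::topological_space set \<Rightarrow> bool" where
  "is_separable X \<longleftrightarrow> (\<exists>D. countable D \<and> D \<subseteq> X \<and> X \<subseteq> closure D)"

text \<open>The natural numbers of the index set start at 1.\<close>

definition index_set :: "nat set \<Rightarrow> bool" where
  "index_set I \<longleftrightarrow> (\<exists>N. I = {1..N}) \<or> I = {1..}"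

text \<open>
  Series over a subset \<open>J\<close> of the index set, as the limit of the partial sums taken in increasing
  order of the indices. (In particular, unconditional convergence is not built in.)
\<close>

definition restrict_terms :: "nat set \<Rightarrow> (nat \<Rightarrow> 'b::zero) \<Rightarrow> nat \<Rightarrow> 'b" where
  "restrict_terms J f = (\<lambda>i. if i \<in> J then f i else 0)"

definition summable_over :: "nat set \<Rightarrow> (nat \<Rightarrow> 'b::real_normed_vector) \<Rightarrow> bool" where
  "summable_over J f \<longleftrightarrow> summable (restrict_terms J f)"

definition sum_over :: "nat set \<Rightarrow> (nat \<Rightarrow> 'b::real_normed_vector) \<Rightarrow> 'b" where
  "sum_over J f = suminf (restrict_terms J f)"

definition tight_frame ::
    "('h::real_normed_vector \<Rightarrow> 'h \<Rightarrow> 'k::real_normed_vector) \<Rightarrow> nat set \<Rightarrow> (nat \<Rightarrow> 'h) \<Rightarrow> bool" where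
  "tight_frame ip I \<phi> \<longleftrightarrow>
     (\<exists>A>0. \<forall>x. summable_over I (\<lambda>i. (norm (ip x (\<phi> i)))\<^sup>2) \<and>
        sum_over I (\<lambda>i. (norm (ip x (\<phi> i)))\<^sup>2) = A * (norm x)\<^sup>2)"

text \<open>
  The three forms of unconditionality. An admissible constant includes the convergence of all the
  series involved, since \<^const>\<open>suminf\<close> is meaningless on divergent series; convergence of the
  frame expansion itself is the case \<open>\<sigma> = I\<close>, respectively \<open>\<epsilon> = 1\<close> or \<open>a = 1\<close>.
\<close>

definition sigma_bound ::
    "('k::rc_scalar \<Rightarrow> 'h::banach \<Rightarrow> 'h) \<Rightarrow> ('h \<Rightarrow> 'h \<Rightarrow> 'k) \<Rightarrow> nat set \<Rightarrow> (nat \<Rightarrow> 'h) \<Rightarrow> real \<Rightarrow> bool" where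
  "sigma_bound smul ip I \<phi> C \<longleftrightarrow>
     (\<forall>x. \<forall>\<sigma>\<subseteq>I. summable_over \<sigma> (\<lambda>i. smul (ip x (\<phi> i)) (\<phi> i)) \<and>
        norm (sum_over \<sigma> (\<lambda>i. smul (ip x (\<phi> i)) (\<phi> i)))
          \<le> C * norm (sum_over I (\<lambda>i. smul (ip x (\<phi> i)) (\<phi> i))))"

definition epsilon_bound ::
    "('k::rc_scalar \<Rightarrow> 'h::banach \<Rightarrow> 'h) \<Rightarrow> ('h \<Rightarrow> 'h \<Rightarrow> 'k) \<Rightarrow> nat set \<Rightarrow> (nat \<Rightarrow> 'h) \<Rightarrow> real \<Rightarrow> bool" where
  "epsilon_bound smul ip I \<phi> C \<longleftrightarrow>
     (\<forall>x. \<forall>\<epsilon>. (\<forall>i\<in>I. \<epsilon> i \<in> {-1, 1}) \<longrightarrow>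
        summable_over I (\<lambda>i. smul (\<epsilon> i * ip x (\<phi> i)) (\<phi> i)) \<and>
        norm (sum_over I (\<lambda>i. smul (\<epsilon> i * ip x (\<phi> i)) (\<phi> i)))
          \<le> C * norm (sum_over I (\<lambda>i. smul (ip x (\<phi> i)) (\<phi> i))))"

definition scalar_bound ::
    "('k::rc_scalar \<Rightarrow> 'h::banach \<Rightarrow> 'h) \<Rightarrow> ('h \<Rightarrow> 'h \<Rightarrow> 'k) \<Rightarrow> nat set \<Rightarrow> (nat \<Rightarrow> 'h) \<Rightarrow> real \<Rightarrow> bool" where
  "scalar_bound smul ip I \<phi> C \<longleftrightarrow>
     (\<forall>x. \<forall>a. (\<forall>i\<in>I. norm (a i) \<le> 1) \<longrightarrow>
        summable_over I (\<lambda>i. smul (a i * ip x (\<phi> i)) (\<phi> i)) \<and>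
        norm (sum_over I (\<lambda>i. smul (a i * ip x (\<phi> i)) (\<phi> i)))
          \<le> C * norm (sum_over I (\<lambda>i. smul (ip x (\<phi> i)) (\<phi> i))))"

definition smallest_constant :: "(real \<Rightarrow> bool) \<Rightarrow> real \<Rightarrow> bool" where
  "smallest_constant P C \<longleftrightarrow> P C \<and> (\<forall>C'. P C' \<longrightarrow> C \<le> C')"

end

theory Submission
  imports Defs
begin

text \<open>
  Write \<open>c\<^sub>i = \<langle>x, \<phi>\<^sub>i\<rangle>\<close> and let \<open>A\<close> be the frame constant. Pairing a finite sum
  \<open>S = \<Sum> b\<^sub>i \<phi>\<^sub>i\<close> with itself and applying the Cauchy-Schwarz inequality to
  \<open>\<parallel>S\<parallel>\<^sup>2 = \<Sum> b\<^sub>i \<langle>\<phi>\<^sub>i, S\<rangle>\<close> gives \<open>\<parallel>S\<parallel>\<^sup>2 \<le> A \<Sum> \<bar>b\<^sub>i\<bar>\<^sup>2\<close>, because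
  \<open>\<Sum> \<bar>\<langle>\<phi>\<^sub>i, S\<rangle>\<bar>\<^sup>2 \<le> A \<parallel>S\<parallel>\<^sup>2\<close> (\<open>norm_synthesis_le\<close>). Hence every series
  \<open>\<Sum> a\<^sub>i c\<^sub>i \<phi>\<^sub>i\<close> with \<open>\<bar>a\<^sub>i\<bar> \<le> 1\<close> converges, and its norm is at most
  \<open>\<surd>A \<surd>(\<Sum> \<bar>c\<^sub>i\<bar>\<^sup>2) = A \<parallel>x\<parallel>\<close> (\<open>norm_frame_multiplier_le\<close>).

  For \<open>a = 1\<close> the bound \<open>A \<parallel>x\<parallel>\<close> is attained: the frame expansion of \<open>x\<close> has inner product
  \<open>\<Sum> \<bar>c\<^sub>i\<bar>\<^sup>2 = A \<parallel>x\<parallel>\<^sup>2\<close> with \<open>x\<close>, so its norm is at least \<open>A \<parallel>x\<parallel>\<close>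
  (\<open>norm_frame_expansion_ge\<close>). Thus the constant 1 is admissible for arbitrary multipliers \<open>a\<close>;
  signs and subsets are the multipliers with values in \<open>{-1, 1}\<close> and \<open>{0, 1}\<close>. No smaller
  constant works, since \<open>a = 1\<close> leaves the expansion unchanged and the expansion of a nonzero
  vector is nonzero.
\<close>

section \<open>Inner products over the scalar field\<close>

lemma scnj_zero [simp]: "scnj 0 = (0 :: 'k::rc_scalar)"
  using scnj_add[of "0::'k" 0] by simp

lemma norm_scnj [simp]: "norm (scnj z) = norm (z :: 'k::rc_scalar)"
proof (cases "z = 0")
  case False
  have "norm (z * scnj z) = (norm z)\<^sup>2"
    by (simp only: mult_scnj) simp
  then show ?thesis
    using False by (simp add: norm_mult power2_eq_square)
qed simp

context hilbert_space
begin

lemma ip_zero_left [simp]: "ip 0 z = 0"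
  using ip_add_left[of 0 0 z] by simp

lemma ip_zero_right [simp]: "ip z 0 = 0"
  using ip_commute[of z 0] by simp

lemma ip_add_right: "ip x (y + z) = ip x y + ip x z"
  by (metis ip_add_left ip_commute scnj_add)

lemma ip_smul_right: "ip x (smul c y) = scnj c * ip x y"
  by (metis ip_smul_left ip_commute scnj_mult)

lemma norm_ip_commute: "norm (ip x y) = norm (ip y x)"
  by (metis ip_commute norm_scnj)

lemma ip_sum_left: "ip (\<Sum>i\<in>F. f i) z = (\<Sum>i\<in>F. ip (f i) z)"
  by (induction F rule: infinite_finite_induct) (simp_all add: ip_add_left)

text \<open>
  Split \<open>x\<close> into its component \<open>c y\<close> along \<open>y\<close> and the orthogonal remainder \<open>u\<close>; by Pythagoras
  the former is not longer than \<open>x\<close>.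
\<close>

lemma norm_ip_le: "norm (ip x y) \<le> norm x * norm y"
proof (cases "y = 0")
  case False
  define c where "c = ip x y / of_real ((norm y)\<^sup>2)"
  define u where "u = x + smul (- c) y"
  have x: "x = u + smul c y"
    by (simp add: u_def scale_minus_left)
  have uy: "ip u y = 0"
    using False by (simp add: u_def ip_add_left ip_smul_left ip_self c_def del: scale_minus_left)
  then have yu: "ip y u = 0"
    using ip_commute[of y u] by simp
  have "ip x x = ip u u + (c * scnj c) * ip y y"
    by (subst (1 2) x) (simp add: ip_add_left ip_add_right ip_smul_left ip_smul_right uy yu)
  then have "(of_real ((norm x)\<^sup>2) :: 'k) = of_real ((norm u)\<^sup>2 + (norm c)\<^sup>2 * (norm y)\<^sup>2)"
    by (simp add: ip_self mult_scnj scaleR_conv_of_real)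
  then have "(norm x)\<^sup>2 = (norm u)\<^sup>2 + (norm c * norm y)\<^sup>2"
    by (simp only: of_real_eq_iff power_mult_distrib)
  then have "(norm c * norm y)\<^sup>2 \<le> (norm x)\<^sup>2"
    by simp
  then have "norm c * norm y \<le> norm x"
    by (rule power2_le_imp_le) simp
  moreover have "norm (ip x y) = (norm c * norm y) * norm y"
    using False by (simp add: c_def norm_divide norm_mult power2_eq_square)
  ultimately show ?thesis
    by (simp add: mult_right_mono)
qed simp

lemma bounded_linear_ip_left: "bounded_linear (\<lambda>z. ip z y)"
proof (rule bounded_linear_intro[where K = "norm y"])
  fix r z
  show "ip (r *\<^sub>R z) y = r *\<^sub>R ip z y"
    using ip_smul_left[of "of_real r" z y] by (simp add: smul_of_real scaleR_conv_of_real)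
qed (simp_all add: ip_add_left norm_ip_le)

end

section \<open>Multipliers of tight sequences\<close>

text \<open>
  Setting the frame vectors outside the index set to 0 turns every series involved into a series
  over all natural numbers; the extended family is called \<open>\<psi>\<close>.
\<close>

locale tight_sequence = hilbert_space smul ip
  for smul :: "'k::rc_scalar \<Rightarrow> 'h::banach \<Rightarrow> 'h" and ip +
  fixes \<psi> :: "nat \<Rightarrow> 'h" and A :: real
  assumes A_pos: "A > 0"
    and tight: "(\<lambda>i. (norm (ip x (\<psi> i)))\<^sup>2) sums (A * (norm x)\<^sup>2)"
begin

text \<open>
  This is the boundedness of the synthesis operator, the adjoint of the analysis operator
  \<open>x \<mapsto> (\<langle>x, \<psi>\<^sub>i\<rangle>)\<^sub>i\<close>, which multiplies norms by \<open>\<surd>A\<close>.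
\<close>

lemma norm_synthesis_le:
  assumes F: "finite F"
  shows "(norm (\<Sum>i\<in>F. smul (b i) (\<psi> i)))\<^sup>2 \<le> A * (\<Sum>i\<in>F. (norm (b i))\<^sup>2)"
proof -
  define S where "S = (\<Sum>i\<in>F. smul (b i) (\<psi> i))"
  let ?B = "\<Sum>i\<in>F. (norm (b i))\<^sup>2"
  have bessel: "(\<Sum>i\<in>F. (norm (ip S (\<psi> i)))\<^sup>2) \<le> A * (norm S)\<^sup>2"
    using sum_le_suminf[OF sums_summable[OF tight[of S]] F] sums_unique[OF tight[of S]] by simp
  have "ip S S = (\<Sum>i\<in>F. b i * ip (\<psi> i) S)"
    by (subst S_def) (simp add: ip_sum_left ip_smul_left)
  then have "(norm S)\<^sup>2 = norm (\<Sum>i\<in>F. b i * ip (\<psi> i) S)"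
    by (metis ip_self norm_of_real abs_of_nonneg zero_le_power2)
  also have "\<dots> \<le> (\<Sum>i\<in>F. norm (b i) * norm (ip S (\<psi> i)))"
    by (rule order_trans[OF norm_sum]) (simp add: norm_mult norm_ip_commute)
  finally have "((norm S)\<^sup>2)\<^sup>2 \<le> (\<Sum>i\<in>F. norm (b i) * norm (ip S (\<psi> i)))\<^sup>2"
    by (rule power_mono) simp
  also have "\<dots> \<le> ?B * (\<Sum>i\<in>F. (norm (ip S (\<psi> i)))\<^sup>2)"
    by (rule Cauchy_Schwarz_ineq_sum)
  also have "\<dots> \<le> ?B * (A * (norm S)\<^sup>2)"
    by (intro mult_left_mono bessel sum_nonneg) simp
  finally have *: "(norm S)\<^sup>2 * (norm S)\<^sup>2 \<le> (A * ?B) * (norm S)\<^sup>2"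
    by (simp add: power2_eq_square algebra_simps)
  have "(norm S)\<^sup>2 \<le> A * ?B"
  proof (cases "S = 0")
    case True
    then show ?thesis
      using A_pos by (simp add: sum_nonneg)
  next
    case False
    then show ?thesis
      using mult_right_le_imp_le[OF *] by simp
  qed
  then show ?thesis
    by (simp only: S_def)
qed

lemma summable_synthesis:
  assumes b: "summable (\<lambda>i. (norm (b i))\<^sup>2)"
  shows "summable (\<lambda>i. smul (b i) (\<psi> i))"
  unfolding summable_Cauchy
proof (intro allI impI)
  fix e :: real assume e: "e > 0"
  then have "e\<^sup>2 / A > 0"
    using A_pos by simp
  then obtain N where N: "\<And>m n. m \<ge> N \<Longrightarrow> norm (\<Sum>i=m..<n. (norm (b i))\<^sup>2) < e\<^sup>2 / A"
    using b unfolding summable_Cauchy by meson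
  show "\<exists>N. \<forall>m\<ge>N. \<forall>n. norm (\<Sum>i=m..<n. smul (b i) (\<psi> i)) < e"
  proof (intro exI allI impI)
    fix m n assume "m \<ge> N"
    then have "(\<Sum>i=m..<n. (norm (b i))\<^sup>2) < e\<^sup>2 / A"
      using N[of m n] by (simp add: sum_nonneg)
    then have "A * (\<Sum>i=m..<n. (norm (b i))\<^sup>2) < e\<^sup>2"
      using A_pos by (simp add: field_simps)
    then have "(norm (\<Sum>i=m..<n. smul (b i) (\<psi> i)))\<^sup>2 < e\<^sup>2"
      by (rule order_le_less_trans[OF norm_synthesis_le, rotated]) simp
    then show "norm (\<Sum>i=m..<n. smul (b i) (\<psi> i)) < e"
      by (rule power2_less_imp_less) (use e in simp)
  qed
qed

context
  fixes a :: "nat \<Rightarrow> 'k"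
  assumes a: "norm (a i) \<le> 1"
begin

lemma norm_multiplied_coefficient_le:
  "(norm (a i * ip x (\<psi> i)))\<^sup>2 \<le> (norm (ip x (\<psi> i)))\<^sup>2"
  using a[of i] by (simp add: norm_mult mult_left_le_one_le)

lemma summable_frame_multiplier: "summable (\<lambda>i. smul (a i * ip x (\<psi> i)) (\<psi> i))"
  by (rule summable_synthesis, rule summable_comparison_test'[OF sums_summable[OF tight[of x]]])
     (use norm_multiplied_coefficient_le in simp)

lemma norm_frame_multiplier_le:
  "norm (\<Sum>i. smul (a i * ip x (\<psi> i)) (\<psi> i)) \<le> A * norm x"
proof (rule LIMSEQ_le_const2)
  show "(\<lambda>n. norm (\<Sum>i<n. smul (a i * ip x (\<psi> i)) (\<psi> i)))
          \<longlonglongrightarrow> norm (\<Sum>i. smul (a i * ip x (\<psi> i)) (\<psi> i))"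
    by (intro tendsto_norm summable_LIMSEQ summable_frame_multiplier)
next
  have "norm (\<Sum>i<n. smul (a i * ip x (\<psi> i)) (\<psi> i)) \<le> A * norm x" for n
  proof -
    have "(norm (\<Sum>i<n. smul (a i * ip x (\<psi> i)) (\<psi> i)))\<^sup>2
            \<le> A * (\<Sum>i<n. (norm (a i * ip x (\<psi> i)))\<^sup>2)"
      by (rule norm_synthesis_le) simp
    also have "\<dots> \<le> A * (\<Sum>i<n. (norm (ip x (\<psi> i)))\<^sup>2)"
      using A_pos by (intro mult_left_mono sum_mono norm_multiplied_coefficient_le) simp
    also have "\<dots> \<le> A * (A * (norm x)\<^sup>2)"
      using A_pos sum_le_suminf[OF sums_summable[OF tight[of x]], of "{..<n}"]
        sums_unique[OF tight[of x]]
      by (intro mult_left_mono) auto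
    also have "\<dots> = (A * norm x)\<^sup>2"
      by (simp add: power2_eq_square)
    finally show ?thesis
      by (rule power2_le_imp_le) (use A_pos in simp)
  qed
  then show "\<exists>N. \<forall>n\<ge>N. norm (\<Sum>i<n. smul (a i * ip x (\<psi> i)) (\<psi> i)) \<le> A * norm x"
    by blast
qed

end

text \<open>
  The inner product of the expansion with \<open>x\<close> is \<open>\<Sum> \<bar>\<langle>x, \<psi>\<^sub>i\<rangle>\<bar>\<^sup>2 = A \<parallel>x\<parallel>\<^sup>2\<close>, so the
  Cauchy-Schwarz inequality bounds the norm of the expansion from below.
\<close>

lemma norm_frame_expansion_ge: "A * norm x \<le> norm (\<Sum>i. smul (ip x (\<psi> i)) (\<psi> i))"
proof (cases "x = 0")
  case False
  let ?T = "\<Sum>i. smul (ip x (\<psi> i)) (\<psi> i)"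
  have "summable (\<lambda>i. smul (ip x (\<psi> i)) (\<psi> i))"
    using summable_frame_multiplier[of "\<lambda>i. 1"] by simp
  then have "(\<lambda>i. ip (smul (ip x (\<psi> i)) (\<psi> i)) x) sums ip ?T x"
    by (intro bounded_linear.sums[OF bounded_linear_ip_left] summable_sums)
  moreover have "ip (smul (ip x (\<psi> i)) (\<psi> i)) x = of_real ((norm (ip x (\<psi> i)))\<^sup>2)" for i
    using mult_scnj[of "ip x (\<psi> i)"] ip_commute[of "\<psi> i" x]
    by (simp add: ip_smul_left scaleR_conv_of_real)
  moreover have "(\<lambda>i. of_real ((norm (ip x (\<psi> i)))\<^sup>2) :: 'k) sums of_real (A * (norm x)\<^sup>2)"
    by (rule sums_of_real[OF tight])
  ultimately have "ip ?T x = of_real (A * (norm x)\<^sup>2)"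
    using sums_unique2 by fastforce
  then have "norm (ip ?T x) = A * (norm x)\<^sup>2"
    by (metis A_pos abs_of_nonneg less_imp_le mult_nonneg_nonneg norm_of_real zero_le_power2)
  then have "(A * norm x) * norm x \<le> norm ?T * norm x"
    using norm_ip_le[of ?T x] by (simp add: power2_eq_square)
  then show ?thesis
    using False by simp
qed simp

end

section \<open>Tight frames over an index set\<close>

lemma (in hilbert_space) tight_sequence_of_tight_frame:
  assumes "tight_frame ip I \<phi>"
  obtains A where "tight_sequence smul ip (restrict_terms I \<phi>) A"
proof -
  obtain A where A: "A > 0" "\<And>x. summable_over I (\<lambda>i. (norm (ip x (\<phi> i)))\<^sup>2)"
    "\<And>x. sum_over I (\<lambda>i. (norm (ip x (\<phi> i)))\<^sup>2) = A * (norm x)\<^sup>2"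
    using assms unfolding tight_frame_def by blast
  have "restrict_terms I (\<lambda>i. (norm (ip x (\<phi> i)))\<^sup>2)
          = (\<lambda>i. (norm (ip x (restrict_terms I \<phi> i)))\<^sup>2)" for x
    by (auto simp: restrict_terms_def)
  then have "(\<lambda>i. (norm (ip x (restrict_terms I \<phi> i)))\<^sup>2) sums (A * (norm x)\<^sup>2)" for x
    using A(2)[of x] A(3)[of x] by (simp add: summable_over_def sum_over_def sums_iff)
  then have "tight_sequence smul ip (restrict_terms I \<phi>) A"
    using A(1) by unfold_locales
  then show ?thesis
    by (rule that)
qed

text \<open>
  Allowing both a subset and multipliers makes this cover the three forms of unconditionality at
  once.
\<close>

lemma (in hilbert_space) tight_frame_multiplier:
  assumes frame: "tight_frame ip I \<phi>" and J: "J \<subseteq> I" and a: "\<And>i. i \<in> J \<Longrightarrow> norm (a i) \<le> 1"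
  shows "summable_over J (\<lambda>i. smul (a i * ip x (\<phi> i)) (\<phi> i))"
    and "norm (sum_over J (\<lambda>i. smul (a i * ip x (\<phi> i)) (\<phi> i)))
           \<le> norm (sum_over I (\<lambda>i. smul (ip x (\<phi> i)) (\<phi> i)))"
proof -
  obtain A where "tight_sequence smul ip (restrict_terms I \<phi>) A"
    using tight_sequence_of_tight_frame[OF frame] .
  then interpret tight_sequence smul ip "restrict_terms I \<phi>" A .
  have a': "norm (restrict_terms J a i) \<le> 1" for i
    by (simp add: restrict_terms_def a)
  have J_terms: "restrict_terms J (\<lambda>i. smul (a i * ip x (\<phi> i)) (\<phi> i))
      = (\<lambda>i. smul (restrict_terms J a i * ip x (restrict_terms I \<phi> i)) (restrict_terms I \<phi> i))"
    using J by (intro ext) (auto simp: restrict_terms_def)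
  have I_terms: "restrict_terms I (\<lambda>i. smul (ip x (\<phi> i)) (\<phi> i))
      = (\<lambda>i. smul (ip x (restrict_terms I \<phi> i)) (restrict_terms I \<phi> i))"
    by (auto simp: restrict_terms_def)
  show "summable_over J (\<lambda>i. smul (a i * ip x (\<phi> i)) (\<phi> i))"
    unfolding summable_over_def J_terms by (rule summable_frame_multiplier[OF a'])
  show "norm (sum_over J (\<lambda>i. smul (a i * ip x (\<phi> i)) (\<phi> i)))
          \<le> norm (sum_over I (\<lambda>i. smul (ip x (\<phi> i)) (\<phi> i)))"
    unfolding sum_over_def J_terms I_terms
    by (rule order_trans[OF norm_frame_multiplier_le[OF a'] norm_frame_expansion_ge])
qed

lemma (in hilbert_space) tight_frame_expansion_nonzero:
  assumes frame: "tight_frame ip I \<phi>" and x: "x \<noteq> 0"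
  shows "norm (sum_over I (\<lambda>i. smul (ip x (\<phi> i)) (\<phi> i))) > 0"
proof -
  obtain A where "tight_sequence smul ip (restrict_terms I \<phi>) A"
    using tight_sequence_of_tight_frame[OF frame] .
  then interpret tight_sequence smul ip "restrict_terms I \<phi>" A .
  have terms: "restrict_terms I (\<lambda>i. smul (ip x (\<phi> i)) (\<phi> i))
      = (\<lambda>i. smul (ip x (restrict_terms I \<phi> i)) (restrict_terms I \<phi> i))"
    by (auto simp: restrict_terms_def)
  have "0 < A * norm x"
    using A_pos x by simp
  then show ?thesis
    unfolding sum_over_def terms using norm_frame_expansion_ge by (rule order_less_le_trans)
qed

theorem corollary3p2:
  fixes smul :: "'k::rc_scalar \<Rightarrow> 'h::banach \<Rightarrow> 'h"
    and ip :: "'h \<Rightarrow> 'h \<Rightarrow> 'k"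
    and \<phi> :: "nat \<Rightarrow> 'h"
    and I :: "nat set"
  assumes "hilbert_space smul ip"
    and "\<exists>x::'h. x \<noteq> 0"
    and "is_separable (UNIV :: 'h set)"
    and "index_set I"
    and "tight_frame ip I \<phi>"
  shows "smallest_constant (sigma_bound smul ip I \<phi>) 1
    \<and> smallest_constant (epsilon_bound smul ip I \<phi>) 1
    \<and> smallest_constant (scalar_bound smul ip I \<phi>) 1"
proof -
  interpret hilbert_space smul ip
    by (rule assms(1))
  note multiplier = tight_frame_multiplier[OF assms(5)]
  let ?T = "\<lambda>x. sum_over I (\<lambda>i. smul (ip x (\<phi> i)) (\<phi> i))"
  obtain x :: 'h where "x \<noteq> 0"
    using assms(2) by blast
  then have Tx: "norm (?T x) > 0"
    by (rule tight_frame_expansion_nonzero[OF assms(5)])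
  have le: "1 \<le> C" if "norm (?T x) \<le> C * norm (?T x)" for C
    using that Tx by simp
  have "sigma_bound smul ip I \<phi> 1"
    unfolding sigma_bound_def using multiplier[where a = "\<lambda>i. 1"] by simp
  moreover have "1 \<le> C" if "sigma_bound smul ip I \<phi> C" for C
    using that unfolding sigma_bound_def by (intro le) blast
  moreover have "epsilon_bound smul ip I \<phi> 1"
    unfolding epsilon_bound_def
  proof (intro allI impI)
    fix x :: 'h and \<epsilon> :: "nat \<Rightarrow> 'k"
    assume "\<forall>i\<in>I. \<epsilon> i \<in> {-1, 1}"
    then have "norm (\<epsilon> i) \<le> 1" if "i \<in> I" for i
      using that by force
    then show "summable_over I (\<lambda>i. smul (\<epsilon> i * ip x (\<phi> i)) (\<phi> i)) \<and>
        norm (sum_over I (\<lambda>i. smul (\<epsilon> i * ip x (\<phi> i)) (\<phi> i))) \<le> 1 * norm (?T x)"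
      using multiplier[where a = \<epsilon> and J = I] by simp
  qed
  moreover have "1 \<le> C" if "epsilon_bound smul ip I \<phi> C" for C
    using that[unfolded epsilon_bound_def, rule_format, of "\<lambda>i. 1" x] by (intro le) simp
  moreover have "scalar_bound smul ip I \<phi> 1"
    unfolding scalar_bound_def using multiplier[where J = I] by simp
  moreover have "1 \<le> C" if "scalar_bound smul ip I \<phi> C" for C
    using that[unfolded scalar_bound_def, rule_format, of "\<lambda>i. 1" x] by (intro le) simp
  ultimately show ?thesis
    unfolding smallest_constant_def by blast
qed

end
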